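(* Let $\mathfrak C$ be the class of finite cyclic groups. The graph $\Gamma_{\mathfrak C}(G)$ is connected for every finite group $G$.
   Context: For a class $\mathfrak F$ of finite groups and a finite group $G$, $\widetilde\Gamma_{\mathfrak F}(G)$ is the graph whose vertices are the elements of $G$ and where $g,h\in G$ are adjacent if and only if $\langle g,h\rangle\notin\mathfrak F$. The graph $\Gamma_{\mathfrak F}(G)$ is obtained from $\widetilde\Gamma_{\mathfrak F}(G)$ by deleting the isolated vertices (those $g\in G$ with $\langle g,h\rangle\in\mathfrak F$ for all $h\in G$); the empty graph is regarded as connected. *)

theory Defs
  imports "HOL-Algebra.Elementary_Groups" "Graph_Theory.Digraph_Component"
begin

text \<open>
  A class of groups is a predicate on groups. The subgroup generated by \<open>g\<close> and \<open>h\<close> is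
  \<^term>\<open>subgroup_generated G {g, h}\<close>, a group structure in its own right to which the predicate
  applies. Undirected graphs are symmetric digraphs whose arcs are pairs of vertices.

  The case \<open>g = h\<close> is not excluded, as the condition for a vertex to be isolated ranges over
  all \<open>h\<close>. For a class containing the cyclic groups this makes no difference: there are no loops.
\<close>

definition full_non_class_graph ::
    "(('a, 'b) monoid_scheme \<Rightarrow> bool) \<Rightarrow> ('a, 'b) monoid_scheme \<Rightarrow> 'a pair_pre_digraph" where
  "full_non_class_graph F G =
     \<lparr>pverts = carrier G,
      parcs = {(g, h). g \<in> carrier G \<and> h \<in> carrier G \<and> \<not> F (subgroup_generated G {g, h})}\<rparr>"

definition isolated_elements ::
    "(('a, 'b) monoid_scheme \<Rightarrow> bool) \<Rightarrow> ('a, 'b) monoid_scheme \<Rightarrow> 'a set" where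
  "isolated_elements F G =
     {g \<in> carrier G. \<forall>h \<in> carrier G. F (subgroup_generated G {g, h})}"

definition non_class_graph ::
    "(('a, 'b) monoid_scheme \<Rightarrow> bool) \<Rightarrow> ('a, 'b) monoid_scheme \<Rightarrow> ('a, 'a \<times> 'a) pre_digraph" where
  "non_class_graph F G =
     with_proj (full_non_class_graph F G) \<restriction> (carrier G - isolated_elements F G)"

definition finite_cyclic_group :: "('a, 'b) monoid_scheme \<Rightarrow> bool" where
  "finite_cyclic_group H \<longleftrightarrow> group H \<and> finite (carrier H) \<and> cyclic_group H"

text \<open>
  The library's \<^const>\<open>Digraph_Component.connected\<close> excludes the graph without vertices, which
  counts as connected here.
\<close>

definition connected_or_empty :: "('a, 'b) pre_digraph \<Rightarrow> bool" where
  "connected_or_empty X \<longleftrightarrow> verts X = {} \<or> Digraph_Component.connected X"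

lemma isolated_elements_iff:
  "g \<in> isolated_elements F G \<longleftrightarrow>
     g \<in> carrier G \<and> (\<forall>h. \<not> g \<rightarrow>\<^bsub>with_proj (full_non_class_graph F G)\<^esub> h)"
  by (auto simp: isolated_elements_def full_non_class_graph_def)

lemma graph_non_cyclic_graph:
  fixes G :: "('a, 'b) monoid_scheme"
  assumes "group G" and fin: "finite (carrier G)"
  shows "graph (non_class_graph finite_cyclic_group G)"
proof -
  interpret group G by fact
  have loops: "finite_cyclic_group (subgroup_generated G {g})" for g
    using fin finite_subset[OF carrier_subgroup_generated_subset]
    by (simp add: finite_cyclic_group_def cyclic_group_generated)
  have fin_arcs: "finite (arcs (non_class_graph finite_cyclic_group G))"
    by (rule finite_subset[OF _ finite_cartesian_product[OF fin fin]])
      (auto simp: non_class_graph_def full_non_class_graph_def)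
  show ?thesis
    by (unfold_locales, rule_tac [4] fin_arcs)
      (auto simp: non_class_graph_def full_non_class_graph_def fin loops symmetric_conv
        arc_to_ends_def insert_commute)
qed

end

theory Submission
  imports Defs
begin

text \<open>
  Call \<open>x\<close> a neighbour of \<open>g\<close> if \<open>\<langle>g, x\<rangle>\<close> is not cyclic. The key is that subgroups of cyclic
  groups are cyclic, so that adjacency passes to roots: if \<open>g\<close> lies in \<open>\<langle>c\<rangle>\<close>, then
  \<open>\<langle>g, x\<rangle> \<le> \<langle>c, x\<rangle>\<close>, and every neighbour of \<open>g\<close> is a neighbour of \<open>c\<close>.

  Now let \<open>g\<close> and \<open>h\<close> be two vertices, with neighbours \<open>x\<close> and \<open>y\<close>. If \<open>\<langle>g, h\<rangle>\<close> is not cyclic, then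
  \<open>g\<close> and \<open>h\<close> are adjacent. Otherwise \<open>\<langle>g, h\<rangle> = \<langle>c\<rangle>\<close> for some \<open>c\<close>, which is adjacent to both \<open>x\<close>
  and \<open>y\<close>, and \<open>g, x, c, y, h\<close> is a walk. Its inner elements have neighbours, so none of them is
  isolated. In particular the diameter is at most \<open>4\<close>.
\<close>

text \<open>
  Division with remainder: if \<open>d > 0\<close> is the least exponent with \<open>c\<^sup>d \<in> H\<close> and \<open>c\<^sup>n \<in> H\<close>, then
  \<open>c\<^bsup>n mod d\<^esup> \<in> H\<close>, whence \<open>n mod d = 0\<close>. If no positive power of \<open>c\<close> lies in \<open>H\<close>, then neither does
  a negative one, and \<open>H\<close> is trivial.
\<close>
lemma (in group) subgroup_of_cyclic_subgroup:
  assumes c: "c \<in> carrier G" and H: "subgroup H G"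
    and sub: "H \<subseteq> carrier (subgroup_generated G {c})"
  obtains d where "d \<in> carrier G" "H = carrier (subgroup_generated G {d})"
proof (cases "\<exists>n::nat. n > 0 \<and> c [^] n \<in> H")
  case True
  define d :: nat where "d = (LEAST n. n > 0 \<and> c [^] n \<in> H)"
  have d: "d > 0" "c [^] d \<in> H"
    using LeastI_ex[OF True] by (auto simp: d_def)
  have least: "d \<le> n" if "n > 0" "c [^] n \<in> H" for n :: nat
    using that by (auto simp: d_def intro: Least_le)
  have pow_H: "y [^] k \<in> H" if "y \<in> H" for y and k :: int
    using that H by (rule subgroup_int_pow_closed[rotated])
  have "H \<subseteq> carrier (subgroup_generated G {c [^] d})"
  proof
    fix y assume "y \<in> H"
    then obtain n :: int where y: "y = c [^] n"
      using sub c by (auto simp: carrier_subgroup_generated_by_singleton)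
    define r where "r = nat (n mod int d)"
    have "c [^] r = c [^] (n + int d * (- (n div int d)))"
      using d by (simp add: r_def minus_mult_div_eq_mod)
    also have "\<dots> = y \<otimes> (c [^] d) [^] (- (n div int d))"
      using c by (simp only: y int_pow_mult int_pow_pow[symmetric] int_pow_int)
    also have "\<dots> \<in> H"
      using \<open>y \<in> H\<close> d H by (intro subgroup.m_closed pow_H)
    finally have "c [^] r \<in> H" .
    moreover have "r < d"
      using d by (simp add: r_def nat_less_iff)
    ultimately have "r = 0"
      using least[of r] by (cases "r = 0") simp_all
    then have "n mod int d = 0"
      using d by (simp add: r_def order_antisym)
    then have "n = int d * (n div int d)"
      by auto
    then have "y = (c [^] d) [^] (n div int d)"
      using c y int_pow_pow[of c "int d" "n div int d"] by (simp only: int_pow_int)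
    then show "y \<in> carrier (subgroup_generated G {c [^] d})"
      using c by (auto simp: carrier_subgroup_generated_by_singleton)
  qed
  moreover have "carrier (subgroup_generated G {c [^] d}) \<subseteq> H"
    using d H by (intro subgroup_generated_minimal) auto
  ultimately show ?thesis
    using c that[of "c [^] d"] by auto
next
  case False
  then have none: "c [^] n \<notin> H" if "n > 0" for n :: nat
    using that by metis
  have "y = \<one>" if "y \<in> H" for y
  proof -
    obtain n :: int where y: "y = c [^] n"
      using \<open>y \<in> H\<close> sub c by (auto simp: carrier_subgroup_generated_by_singleton)
    have "inv y \<in> H"
      using H that by (rule subgroup.m_inv_closed)
    then have "c [^] \<bar>n\<bar> \<in> H"
      using \<open>y \<in> H\<close> c by (simp add: y int_pow_neg abs_if)
    then have "n = 0"
      using none[of "nat \<bar>n\<bar>"] by (cases "n = 0") simp_all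
    then show ?thesis
      by (simp add: y)
  qed
  then have "H = {\<one>}"
    using subgroup.one_closed[OF H] by blast
  then have "H = carrier (subgroup_generated G {\<one>})"
    by (simp add: carrier_subgroup_generated_by_singleton image_constant_conv)
  then show ?thesis
    using that by blast
qed

text \<open>
  An equation between subsets of \<open>G\<close> replaces one between group structures, so that the subgroups
  of a cyclic \<open>\<langle>S\<rangle>\<close> can be treated as subgroups of \<open>G\<close>.
\<close>
lemma (in group) cyclic_subgroup_generated_iff:
  "cyclic_group (subgroup_generated G S) \<longleftrightarrow>
     (\<exists>c \<in> carrier G. carrier (subgroup_generated G S) = carrier (subgroup_generated G {c}))"
    (is "_ = (\<exists>c \<in> _. ?S = _)")
proof -
  have gen: "c \<in> ?S \<and> ?S = range (\<lambda>n::int. c [^]\<^bsub>subgroup_generated G S\<^esub> n) \<longleftrightarrow>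
      c \<in> carrier G \<and> ?S = carrier (subgroup_generated G {c})" for c
  proof (cases "c \<in> ?S")
    case True
    then show ?thesis
      using carrier_subgroup_generated_subset[of S]
      by (auto simp: int_pow_subgroup_generated carrier_subgroup_generated_by_singleton)
  next
    case False
    then show ?thesis
      using subgroup_generated_subset_carrier_subset[of "{c}"] by auto
  qed
  show ?thesis
    unfolding group.cyclic_group[OF group_subgroup_generated] Bex_def gen ..
qed

lemma (in group) cyclic_subgroup_generated_mono:
  assumes "cyclic_group (subgroup_generated G T)"
    and "S \<subseteq> carrier (subgroup_generated G T)"
  shows "cyclic_group (subgroup_generated G S)"
proof -
  obtain c where c: "c \<in> carrier G"
      "carrier (subgroup_generated G T) = carrier (subgroup_generated G {c})"
    by (rule bexE[OF iffD1[OF cyclic_subgroup_generated_iff assms(1)]])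
  have "carrier (subgroup_generated G S) \<subseteq> carrier (subgroup_generated G {c})"
    using assms(2) c by (intro subgroup_generated_minimal subgroup_subgroup_generated) simp
  then obtain d where "d \<in> carrier G"
      "carrier (subgroup_generated G S) = carrier (subgroup_generated G {d})"
    by (rule subgroup_of_cyclic_subgroup[OF c(1) subgroup_subgroup_generated])
  then show ?thesis
    by (intro iffD2[OF cyclic_subgroup_generated_iff] bexI)
qed

text \<open>
  Roots inherit all neighbours: \<open>\<langle>g, x\<rangle> \<le> \<langle>c, x\<rangle>\<close>, and a group with a non-cyclic subgroup is not cyclic.
\<close>
lemma (in group) not_cyclic_root:
  assumes "c \<in> carrier G" "x \<in> carrier G" "g \<in> carrier (subgroup_generated G {c})"
    and "\<not> cyclic_group (subgroup_generated G {g, x})"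
  shows "\<not> cyclic_group (subgroup_generated G {c, x})"
proof -
  have gens: "{c, x} \<subseteq> carrier (subgroup_generated G {c, x})"
    using assms by (intro subgroup_generated_subset_carrier_subset) auto
  then have "carrier (subgroup_generated G {c}) \<subseteq> carrier (subgroup_generated G {c, x})"
    by (intro subgroup_generated_minimal subgroup_subgroup_generated) auto
  then have "{g, x} \<subseteq> carrier (subgroup_generated G {c, x})"
    using assms(3) gens by auto
  then show ?thesis
    using assms(4) cyclic_subgroup_generated_mono[of "{c, x}" "{g, x}"] by blast
qed

lemma verts_non_class_graph:
  "g \<in> verts (non_class_graph F G) \<longleftrightarrow>
     g \<in> carrier G \<and> (\<exists>h \<in> carrier G. \<not> F (subgroup_generated G {g, h}))"
  by (auto simp: non_class_graph_def isolated_elements_def)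

text \<open>Deleting the isolated vertices removes no edge, as both ends of an edge have a neighbour.\<close>
lemma adjacent_non_class_graph:
  "g \<rightarrow>\<^bsub>non_class_graph F G\<^esub> h \<longleftrightarrow>
     g \<in> carrier G \<and> h \<in> carrier G \<and> \<not> F (subgroup_generated G {g, h})"
  by (auto simp: non_class_graph_def full_non_class_graph_def isolated_elements_def
      arcs_ends_conv insert_commute)

theorem corollary19:
  fixes G :: "('a, 'b) monoid_scheme"
  assumes "group G" and "finite (carrier G)"
  shows "connected_or_empty (non_class_graph finite_cyclic_group G)"
proof -
  interpret group G by fact
  let ?\<Gamma> = "non_class_graph finite_cyclic_group G"
  interpret \<Gamma>: graph ?\<Gamma>
    using assms by (rule graph_non_cyclic_graph)
  have class_iff: "finite_cyclic_group (subgroup_generated G S) \<longleftrightarrow>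
      cyclic_group (subgroup_generated G S)" for S
    using finite_subset[OF carrier_subgroup_generated_subset assms(2)]
    by (simp add: finite_cyclic_group_def)
  note adjacent = adjacent_non_class_graph[where F = finite_cyclic_group and G = G,
      unfolded class_iff]
  have reach: "g \<rightarrow>\<^sup>*\<^bsub>?\<Gamma>\<^esub> h" if verts: "g \<in> verts ?\<Gamma>" "h \<in> verts ?\<Gamma>" for g h
  proof (cases "cyclic_group (subgroup_generated G {g, h})")
    case False
    then have "g \<rightarrow>\<^bsub>?\<Gamma>\<^esub> h"
      using verts by (simp add: adjacent verts_non_class_graph)
    then show ?thesis
      by (rule \<Gamma>.reachable_adjI)
  next
    case True
    then obtain c where c: "c \<in> carrier G"
        "carrier (subgroup_generated G {g, h}) = carrier (subgroup_generated G {c})"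
      by (rule bexE[OF iffD1[OF cyclic_subgroup_generated_iff]])
    have roots: "{g, h} \<subseteq> carrier (subgroup_generated G {c})"
      using verts unfolding c(2)[symmetric]
      by (intro subgroup_generated_subset_carrier_subset) (auto simp: verts_non_class_graph)
    obtain x y where x: "g \<rightarrow>\<^bsub>?\<Gamma>\<^esub> x" and y: "h \<rightarrow>\<^bsub>?\<Gamma>\<^esub> y"
      using verts by (auto simp: verts_non_class_graph adjacent_non_class_graph)
    have "c \<rightarrow>\<^bsub>?\<Gamma>\<^esub> x" "c \<rightarrow>\<^bsub>?\<Gamma>\<^esub> y"
      using x y c(1) roots not_cyclic_root[of c x g] not_cyclic_root[of c y h]
      by (simp_all add: adjacent)
    then have "c \<rightarrow>\<^sup>*\<^bsub>?\<Gamma>\<^esub> g" "c \<rightarrow>\<^sup>*\<^bsub>?\<Gamma>\<^esub> h"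
      using x[THEN \<Gamma>.reachable_adjI, THEN \<Gamma>.symmetric_reachable']
        y[THEN \<Gamma>.reachable_adjI, THEN \<Gamma>.symmetric_reachable']
      by (simp_all only: \<Gamma>.adj_reachable_trans)
    then show ?thesis
      by (rule \<Gamma>.reachable_trans[OF \<Gamma>.symmetric_reachable'])
  qed
  show ?thesis
  proof (cases "verts ?\<Gamma> = {}")
    case False
    then have "Digraph_Component.connected ?\<Gamma>"
      using reach
      by (intro \<Gamma>.connectedI) (simp_all add: \<Gamma>.reachable_mk_symmetric_eq[OF \<Gamma>.sym_arcs])
    then show ?thesis
      by (simp add: connected_or_empty_def)
  qed (simp add: connected_or_empty_def)
qed

end
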